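(* For any $k,g\in\mathbb{N}$, there exists a graph $G$ with $\chi(G)=k$ and girth at least $g$, such that $R_{\chi}(G)=R(k)$.
   Context: $\mathbb{N}$ denotes the positive integers. All graphs are finite and simple. $\chi(G)$ is the chromatic number of $G$. The girth of a graph is the length of a shortest cycle in it, and is $\infty$ if the graph contains no cycle. $R(k)$ is the classical Ramsey number: the smallest integer $N$ such that any $2$-coloring of the edges of the clique $K_N$ results in a monochromatic copy of the clique $K_k$. A copy of $G$ is a graph obtained by relabeling the vertices of $G$; copies are sought as (not necessarily induced) subgraphs. The chromatic Ramsey number $R_{\chi}(G)$ is the smallest integer $N$ such that there exists a graph $F$ with $\chi(F)=N$ for which every $2$-coloring of the edges of $F$ results in a monochromatic copy of $G$. Copies of graphs with no edges count as (vacuously) monochromatic; so $R(1)=1$, and $R_\chi(G)=1$ for a graph $G$ with at least one vertex and no edges. *)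

theory Defs
  imports Main "HOL-Library.Ramsey" "HOL-Library.Extended_Nat"
begin

text \<open>
  A graph is a pair of a vertex set and an edge set whose members are two-element subsets
  of the vertex set. Finite graphs are considered up to isomorphism only, so wherever one
  is quantified existentially its vertices may be taken to be natural numbers.
\<close>

type_synonym 'a ugraph = "'a set \<times> 'a set set"

abbreviation verts :: "'a ugraph \<Rightarrow> 'a set" where "verts G \<equiv> fst G"
abbreviation edges :: "'a ugraph \<Rightarrow> 'a set set" where "edges G \<equiv> snd G"

definition fin_ugraph :: "'a ugraph \<Rightarrow> bool" where
  "fin_ugraph G \<longleftrightarrow> finite (verts G) \<and> edges G \<subseteq> [verts G]\<^bsup>2\<^esup>"

definition complete_ugraph :: "'a set \<Rightarrow> 'a ugraph" where
  "complete_ugraph V = (V, [V]\<^bsup>2\<^esup>)"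

definition proper_coloring :: "'a ugraph \<Rightarrow> nat \<Rightarrow> ('a \<Rightarrow> nat) \<Rightarrow> bool" where
  "proper_coloring G m c \<longleftrightarrow>
     c \<in> verts G \<rightarrow> {..<m} \<and> (\<forall>u v. {u, v} \<in> edges G \<longrightarrow> c u \<noteq> c v)"

definition chromatic_number :: "'a ugraph \<Rightarrow> nat" where
  "chromatic_number G = (LEAST m. \<exists>c. proper_coloring G m c)"

definition is_cycle :: "'a ugraph \<Rightarrow> 'a list \<Rightarrow> bool" where
  "is_cycle G p \<longleftrightarrow>
     3 \<le> length p \<and> distinct p \<and> set p \<subseteq> verts G \<and>
     (\<forall>i < length p. {p ! i, p ! (Suc i mod length p)} \<in> edges G)"

text \<open>The infimum over the empty set is \<open>\<infinity>\<close>, as required for acyclic graphs.\<close>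

definition girth :: "'a ugraph \<Rightarrow> enat" where
  "girth G = (INF p \<in> {p. is_cycle G p}. enat (length p))"

definition is_copy :: "'b ugraph \<Rightarrow> 'a ugraph \<Rightarrow> ('b \<Rightarrow> 'a) \<Rightarrow> bool" where
  "is_copy G F f \<longleftrightarrow>
     inj_on f (verts G) \<and> f ` verts G \<subseteq> verts F \<and> (\<forall>e \<in> edges G. f ` e \<in> edges F)"

text \<open>
  Every 2-coloring \<open>c\<close> of the edges of \<open>F\<close> yields a monochromatic copy of \<open>G\<close>.
  Values of \<open>c\<close> outside the edge set of \<open>F\<close> play no role.
\<close>

definition arrows :: "'a ugraph \<Rightarrow> 'b ugraph \<Rightarrow> bool" where
  "arrows F G \<longleftrightarrow>
     (\<forall>c :: 'a set \<Rightarrow> bool. \<exists>f b. is_copy G F f \<and> (\<forall>e \<in> edges G. c (f ` e) = b))"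

definition ramsey_number :: "nat \<Rightarrow> nat" where
  "ramsey_number k =
     (LEAST N. arrows (complete_ugraph {..<N}) (complete_ugraph {..<k}))"

definition chromatic_ramsey_number :: "'a ugraph \<Rightarrow> nat" where
  "chromatic_ramsey_number G =
     (LEAST N. \<exists>F :: nat ugraph. fin_ugraph F \<and> chromatic_number F = N \<and> arrows F G)"

text \<open>
  The minima above are attained, so none of the uses of \<open>LEAST\<close> is degenerate.
\<close>

lemma proper_coloring_exists:
  assumes "fin_ugraph G"
  shows "\<exists>m c. proper_coloring G m c"
proof -
  obtain c :: "'a \<Rightarrow> nat" and n where c: "c ` verts G = {i. i < n}" "inj_on c (verts G)"
    using assms finite_imp_inj_to_nat_seg unfolding fin_ugraph_def by metis
  have "c u \<noteq> c v" if e: "{u, v} \<in> edges G" for u v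
  proof -
    have "{u, v} \<in> [verts G]\<^bsup>2\<^esup>" using assms e unfolding fin_ugraph_def by blast
    then have "u \<in> verts G" "v \<in> verts G" "u \<noteq> v" by (auto simp: nsets_def)
    then show ?thesis using c(2) by (auto dest: inj_onD)
  qed
  moreover have "c \<in> verts G \<rightarrow> {..<n}" using c(1) by auto
  ultimately show ?thesis unfolding proper_coloring_def by blast
qed

lemma chromatic_number_complete: "chromatic_number (complete_ugraph {..<N}) = N"
  unfolding chromatic_number_def
proof (rule Least_equality)
  show "\<exists>c. proper_coloring (complete_ugraph {..<N}) N c"
    by (rule exI[of _ id]) (auto simp: proper_coloring_def complete_ugraph_def nsets_def)
next
  fix m assume "\<exists>c. proper_coloring (complete_ugraph {..<N}) m c"
  then obtain c where c: "c \<in> {..<N} \<rightarrow> {..<m}"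
      "\<And>u v. {u, v} \<in> [{..<N}]\<^bsup>2\<^esup> \<Longrightarrow> c u \<noteq> c v"
    by (auto simp: proper_coloring_def complete_ugraph_def)
  have "inj_on c {..<N}"
  proof (rule inj_onI, rule ccontr)
    fix u v assume "u \<in> {..<N}" "v \<in> {..<N}" "c u = c v" "u \<noteq> v"
    then show False using c(2)[of u v] by (auto simp: nsets_def)
  qed
  then show "N \<le> m"
    using c(1) card_inj_on_le[of c "{..<N}" "{..<m}"] by auto
qed

lemma arrows_complete_exists:
  "\<exists>N. arrows (complete_ugraph {..<N :: nat}) (complete_ugraph {..<k :: nat})"
proof -
  obtain N :: nat where N: "partn_lst {..<N} [k, k] 2"
    using ramsey_full by blast
  have "\<exists>f b. is_copy (complete_ugraph {..<k}) (complete_ugraph {..<N}) f \<and>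
          (\<forall>e \<in> edges (complete_ugraph {..<k}). c (f ` e) = b)" for c :: "nat set \<Rightarrow> bool"
  proof -
    define c' where "c' = (\<lambda>e. if c e then 1 else 0 :: nat)"
    have c': "c' \<in> [{..<N}]\<^bsup>2\<^esup> \<rightarrow> {..<2}" by (auto simp: c'_def)
    have "length [k, k] = 2" by simp
    then obtain i H where i: "i < 2" and H: "H \<in> [{..<N}]\<^bsup>([k, k] ! i)\<^esup>"
      and mono: "c' ` ([H]\<^bsup>2\<^esup>) \<subseteq> {i}"
      using partn_lstE[OF N c'] by metis
    have H': "H \<subseteq> {..<N}" "finite H" "card H = k"
      using H i by (auto simp: nsets_def less_2_cases_iff)
    then obtain f where f: "bij_betw f {..<k} H"
      by (metis card_lessThan finite_lessThan finite_same_card_bij)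
    have img: "f ` e \<in> [H]\<^bsup>2\<^esup>" if "e \<in> [{..<k}]\<^bsup>2\<^esup>" for e
    proof -
      have "e \<subseteq> {..<k}" "card e = 2" "finite e" using that by (auto simp: nsets_def)
      moreover from this have "inj_on f e" using f by (meson bij_betw_def inj_on_subset)
      ultimately show ?thesis using f
        by (auto simp: nsets_def card_image bij_betw_def)
    qed
    have "is_copy (complete_ugraph {..<k}) (complete_ugraph {..<N}) f"
      using f H' img nsets_mono[OF H'(1), of 2]
      by (auto simp: is_copy_def complete_ugraph_def bij_betw_def)
    moreover have "c (f ` e) = (i = 1)" if "e \<in> [{..<k}]\<^bsup>2\<^esup>" for e
    proof -
      have "c' (f ` e) = i" using mono img[OF that] by blast
      then show ?thesis by (auto simp: c'_def split: if_splits)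
    qed
    ultimately show ?thesis by (auto simp: complete_ugraph_def)
  qed
  then show ?thesis unfolding arrows_def by blast
qed

lemma chromatic_ramsey_witness_exists:
  fixes G :: "'a ugraph"
  assumes "fin_ugraph G"
  shows "\<exists>N. \<exists>F :: nat ugraph. fin_ugraph F \<and> chromatic_number F = N \<and> arrows F G"
proof -
  define k where "k = card (verts G)"
  obtain N :: nat where N: "arrows (complete_ugraph {..<N}) (complete_ugraph {..<k})"
    using arrows_complete_exists by blast
  obtain h where h: "bij_betw h (verts G) {..<k}"
    using assms unfolding fin_ugraph_def k_def
    by (metis card_lessThan finite_lessThan finite_same_card_bij)
  have he: "h ` e \<in> [{..<k}]\<^bsup>2\<^esup>" if "e \<in> edges G" for e
  proof -
    have e: "e \<subseteq> verts G" "card e = 2" "finite e"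
      using assms that by (auto simp: fin_ugraph_def nsets_def)
    then have "inj_on h e" using h by (meson bij_betw_def inj_on_subset)
    then show ?thesis using e h by (auto simp: nsets_def card_image bij_betw_def)
  qed
  have "arrows (complete_ugraph {..<N}) G"
    unfolding arrows_def
  proof
    fix c :: "nat set \<Rightarrow> bool"
    obtain f b where f: "is_copy (complete_ugraph {..<k}) (complete_ugraph {..<N}) f"
      "\<forall>e \<in> [{..<k}]\<^bsup>2\<^esup>. c (f ` e) = b"
      using N unfolding arrows_def complete_ugraph_def snd_conv by blast
    have fh: "(f \<circ> h) ` A = f ` (h ` A)" for A
      by (rule image_comp [symmetric])
    have "is_copy G (complete_ugraph {..<N}) (f \<circ> h)"
      using f(1) h he unfolding is_copy_def complete_ugraph_def bij_betw_def
      unfolding fh by (simp add: comp_inj_on)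
    moreover have "\<forall>e \<in> edges G. c ((f \<circ> h) ` e) = b"
      using f(2) he unfolding fh by simp
    ultimately show "\<exists>f b. is_copy G (complete_ugraph {..<N}) f \<and>
        (\<forall>e \<in> edges G. c (f ` e) = b)" by blast
  qed
  moreover have "fin_ugraph (complete_ugraph {..<N})"
    by (simp add: fin_ugraph_def complete_ugraph_def)
  ultimately show ?thesis by blast
qed

end

theory Submission
  imports Defs Complex_Main
begin

text \<open>
  The graph is a \<open>k\<close>-partite graph of large girth in which every coloring of the vertices with
  \<open>R(k)\<close> colors has \<open>k\<close> classes pairwise joined by edges. If \<open>\<chi>(F) = m < R(k)\<close>, pulling a bad
  edge coloring of \<open>K\<^sub>m\<close> back to \<open>F\<close> along a proper coloring leaves no monochromatic copy of \<open>G\<close>.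
  Conversely, iterating the bipartite Ramsey theorem on a complete \<open>R(k)\<close>-partite graph with large
  parts makes all pairs of parts monochromatic, and Ramsey's theorem for the parts then yields \<open>k\<close>
  parts into which any \<open>k\<close>-partite graph of bounded order embeds monochromatically.

  The sparse graph is built without probability: edges are added greedily, each one chosen, among
  the pairs that create no short cycle and respect a degree bound, so as to hit a constant
  fraction of the edge sets between large parts that have not been hit yet. There are at most
  \<open>4\<^sup>n\<close> such sets, so linearly many edges suffice.
\<close>

section \<open>Cycles, walks and degrees\<close>

lemma enat_le_girth_iff: "enat g \<le> girth G \<longleftrightarrow> (\<forall>p. is_cycle G p \<longrightarrow> g \<le> length p)"
  by (auto simp: girth_def le_INF_iff)

lemma is_cycle_mono: "is_cycle (V, E) p \<Longrightarrow> E \<subseteq> E' \<Longrightarrow> is_cycle (V, E') p"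
  by (auto simp: is_cycle_def)

text \<open>A relation rather than a predicate, so that \<open>adj_rel E ^^ j\<close> relates the
  ends of the walks of length \<open>j\<close>.\<close>

definition adj_rel :: "'a set set \<Rightarrow> ('a \<times> 'a) set" where
  "adj_rel E = {(u, v). {u, v} \<in> E}"

definition edge_degree :: "'a set set \<Rightarrow> 'a \<Rightarrow> nat" where
  "edge_degree E v = card {e \<in> E. v \<in> e}"

lemma nth_mod_eq_iff:
  assumes "distinct p" "p \<noteq> []"
  shows "p ! (a mod length p) = p ! (b mod length p) \<longleftrightarrow> a mod length p = b mod length p"
  using assms by (simp add: nth_eq_iff_index_eq)

text \<open>A cycle that appears only when \<open>e\<close> is added must use \<open>e\<close>; the
  rest of the cycle is a walk in \<open>E\<close> between the two ends of \<open>e\<close>.\<close>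

lemma cycle_new_edge_path:
  assumes cyc: "is_cycle (V, insert e E) p" and no: "\<not> is_cycle (V, E) p"
  obtains u v where "e = {u, v}" "(u, v) \<in> adj_rel E ^^ (length p - 1)"
proof -
  define n where "n = length p"
  have n: "3 \<le> n" and dist: "distinct p" and sub: "set p \<subseteq> V"
    and ed: "\<And>i. i < n \<Longrightarrow> {p ! i, p ! (Suc i mod n)} \<in> insert e E"
    using cyc by (auto simp: is_cycle_def n_def)
  obtain i where i: "i < n" "{p ! i, p ! (Suc i mod n)} \<notin> E"
    using no n dist sub by (auto simp: is_cycle_def n_def)
  have e: "e = {p ! i, p ! (Suc i mod n)}" using ed[OF i(1)] i(2) by auto
  have nth_eq: "p ! (a mod n) = p ! (b mod n) \<longleftrightarrow> a mod n = b mod n" for a b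
    using n dist unfolding n_def by (intro nth_mod_eq_iff) auto
  \<comment> \<open>The walk starts at the far end of edge \<open>i\<close> and follows the cycle;
    after \<open>n - 1\<close> steps it reaches \<open>p ! i\<close> without having used edge
    \<open>i\<close>.\<close>
  have path: "(p ! (Suc i mod n), p ! ((Suc i + t) mod n)) \<in> adj_rel E ^^ t" if "t \<le> n - 1" for t
    using that
  proof (induction t)
    case (Suc t)
    let ?a = "Suc i + t"
    have "{p ! (?a mod n), p ! (Suc ?a mod n)} \<in> insert e E"
      using ed[of "?a mod n"] n by (simp add: mod_Suc_eq)
    moreover have "{p ! (?a mod n), p ! (Suc ?a mod n)} \<noteq> e"
    proof
      assume "{p ! (?a mod n), p ! (Suc ?a mod n)} = e"
      then have "(?a mod n = i mod n) \<or> (?a mod n = Suc i mod n \<and> Suc ?a mod n = i mod n)"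
        unfolding e doubleton_eq_iff using nth_eq[of _ i] nth_eq[of _ "Suc i"] i(1) by auto
      then show False
      proof (elim disjE conjE)
        assume "?a mod n = i mod n"
        \<comment> \<open>Here \<open>?a - i\<close> is \<open>Suc t\<close>, which lies strictly
          between 0 and \<open>n\<close>.\<close>
        then have "n dvd ?a - i" by (metis le_add2 mod_eq_dvd_iff_nat add_Suc add_Suc_right add.commute)
        then show False using Suc.prems n by (auto dest: dvd_imp_le)
      next
        assume "?a mod n = Suc i mod n" "Suc ?a mod n = i mod n"
        then have "Suc (Suc i) mod n = i mod n" by (metis mod_Suc_eq)
        \<comment> \<open>Traversing \<open>e\<close> backwards would force \<open>n\<close> to
          divide 2.\<close>
        then have "n dvd Suc (Suc i) - i" by (metis le_SucI order_refl mod_eq_dvd_iff_nat)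
        then show False using n by (auto dest: dvd_imp_le)
      qed
    qed
    ultimately have "(p ! (?a mod n), p ! (Suc ?a mod n)) \<in> adj_rel E"
      by (auto simp: adj_rel_def)
    then show ?case using Suc by auto
  qed simp
  have "(Suc i + (n - 1)) mod n = i" using i n by simp
  with path[of "n - 1"] show thesis
    using that[of "p ! (Suc i mod n)" "p ! i"] e by (auto simp: n_def insert_commute)
qed

text \<open>Each further step of a walk has at most \<open>d\<close> continuations. Finiteness is
  carried through the same induction because the union bound needs a finite index set.\<close>

lemma card_adj_rel_pow:
  assumes "finite E" "\<And>v. edge_degree E v \<le> d"
  shows "finite ((adj_rel E ^^ j) `` {u}) \<and> card ((adj_rel E ^^ j) `` {u}) \<le> d ^ j"
proof (induction j)
  case (Suc j)
  have nb: "finite (adj_rel E `` {v}) \<and> card (adj_rel E `` {v}) \<le> d" for v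
  proof -
    have inj: "inj_on (\<lambda>w. {v, w}) (adj_rel E `` {v})"
      by (auto simp: inj_on_def doubleton_eq_iff)
    have sub: "(\<lambda>w. {v, w}) ` (adj_rel E `` {v}) \<subseteq> {e \<in> E. v \<in> e}"
      by (auto simp: adj_rel_def)
    have fin: "finite {e \<in> E. v \<in> e}" using assms by simp
    show ?thesis
      using inj_on_finite[OF inj sub fin] card_inj_on_le[OF inj sub fin] assms(2)[of v]
      by (auto simp: edge_degree_def)
  qed
  have eq: "(adj_rel E ^^ Suc j) `` {u} = (\<Union>v \<in> (adj_rel E ^^ j) `` {u}. adj_rel E `` {v})"
    by auto
  have "card ((adj_rel E ^^ Suc j) `` {u}) \<le> (\<Sum>v \<in> (adj_rel E ^^ j) `` {u}. card (adj_rel E `` {v}))"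
    unfolding eq using Suc by (intro card_UN_le) auto
  also have "\<dots> \<le> card ((adj_rel E ^^ j) `` {u}) * d"
    using nb by (intro sum_bounded_above[of _ _ d, simplified]) auto
  also have "\<dots> \<le> d ^ j * d" using Suc by simp
  finally show ?case using Suc nb unfolding eq by (auto simp: mult.commute)
qed simp

text \<open>The handshake lemma, by double counting incidences.\<close>

lemma sum_edge_degree:
  assumes "finite V" "E \<subseteq> [V]\<^bsup>2\<^esup>"
  shows "(\<Sum>v\<in>V. edge_degree E v) = 2 * card E"
proof -
  have "finite E" using assms finite_subset finite_imp_finite_nsets by metis
  moreover have "card {v \<in> V. v \<in> e} = 2" if "e \<in> E" for e
  proof -
    have "{v \<in> V. v \<in> e} = e" "card e = 2" using that assms by (auto simp: nsets_def)
    then show ?thesis by simp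
  qed
  ultimately show ?thesis
    unfolding edge_degree_def using assms(1) by (intro sum_multicount) auto
qed

section \<open>Greedy choice of edges under girth and degree constraints\<close>

text \<open>
  \<open>A\<close> is what remains of all pairs after discarding those that meet a vertex of full degree or
  join vertices at distance less than \<open>g\<close>.
\<close>

lemma greedy_allowed_pairs:
  fixes V :: "'a set"
  assumes V: "finite V" and E: "E \<subseteq> [V]\<^bsup>2\<^esup>" and deg: "\<And>v. edge_degree E v \<le> d"
    and cardE: "card E \<le> C * card V" and d: "d = 8 * C * L" and C: "C > 0" and L: "L > 0"
    and N: "4 * L * g * d ^ g \<le> card V"
    and girth: "\<And>p. is_cycle (V, E) p \<Longrightarrow> g \<le> length p"
  obtains A where "A \<subseteq> [V]\<^bsup>2\<^esup>"
    "\<And>B. B \<subseteq> [V]\<^bsup>2\<^esup> \<Longrightarrow> (card V)\<^sup>2 \<le> L * card B \<Longrightarrow> (card V)\<^sup>2 \<le> 2 * L * card (A \<inter> B)"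
    "\<And>e v. e \<in> A \<Longrightarrow> edge_degree (insert e E) v \<le> d"
    "\<And>e p. e \<in> A \<Longrightarrow> is_cycle (V, insert e E) p \<Longrightarrow> g \<le> length p"
proof -
  let ?N = "card V"
  have finE: "finite E" using V E finite_subset finite_imp_finite_nsets by metis
  define hi where "hi = {v \<in> V. edge_degree E v = d}"
  define close where "close = (\<lambda>u. \<Union>j<g. (adj_rel E ^^ j) `` {u})"
  \<comment> \<open>The forbidden pairs are counted as ordered pairs, where the bound is a plain sum
    over first coordinates; \<open>F\<close> then forgets the order.\<close>
  define X where "X = (SIGMA u:V. close u) \<union> hi \<times> V"
  define F where "F = (\<lambda>(u, v). {u, v}) ` X"
  define A where "A = [V]\<^bsup>2\<^esup> - F"
  have dpos: "d > 0" using d C L by simp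
  \<comment> \<open>The average degree is at most \<open>2 * C\<close>, and \<open>d\<close> is
    \<open>4 * L\<close> times that, so at most a \<open>1 / (4 * L)\<close> fraction of the
    vertices can have full degree.\<close>
  have hi: "4 * L * card hi \<le> ?N"
  proof -
    have "card hi * d = (\<Sum>v\<in>hi. edge_degree E v)" by (simp add: hi_def)
    also have "\<dots> \<le> (\<Sum>v\<in>V. edge_degree E v)" using V by (intro sum_mono2) (auto simp: hi_def)
    also have "\<dots> = 2 * card E" by (rule sum_edge_degree[OF V E])
    also have "\<dots> \<le> 2 * (C * ?N)" using cardE by simp
    finally have "(2 * C) * (4 * L * card hi) \<le> (2 * C) * ?N" unfolding d by (simp add: mult.assoc mult.left_commute mult.commute)
    then show ?thesis using C by simp
  qed
  have close: "finite (close u)" "card (close u) \<le> g * d ^ g" for u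
  proof -
    show "finite (close u)" unfolding close_def using card_adj_rel_pow[OF finE deg] by blast
    have "card (close u) \<le> (\<Sum>j<g. card ((adj_rel E ^^ j) `` {u}))"
      unfolding close_def by (intro card_UN_le) auto
    also have "\<dots> \<le> (\<Sum>j<g. d ^ g)"
    proof (intro sum_mono)
      fix j assume "j \<in> {..<g}"
      then have "d ^ j \<le> d ^ g" using dpos by (intro power_increasing) auto
      then show "card ((adj_rel E ^^ j) `` {u}) \<le> d ^ g"
        using card_adj_rel_pow[OF finE deg, of j u] by linarith
    qed
    finally show "card (close u) \<le> g * d ^ g" by simp
  qed
  have finX: "finite X" unfolding X_def hi_def using V close by auto
  have "card X \<le> card (SIGMA u:V. close u) + card (hi \<times> V)"
    unfolding X_def by (rule card_Un_le)
  also have "card (SIGMA u:V. close u) = (\<Sum>u\<in>V. card (close u))"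
    using V close by simp
  also have "\<dots> \<le> ?N * (g * d ^ g)" using close by (intro sum_bounded_above[of V _ "g * d ^ g", simplified]) auto
  also have "card (hi \<times> V) = card hi * ?N" by (simp add: card_cartesian_product)
  finally have "card X \<le> ?N * (g * d ^ g) + card hi * ?N" by simp
  \<comment> \<open>Close pairs and pairs at full vertices each number at most
    \<open>?N\<^sup>2 / (4 * L)\<close>. Together they are at most half of the
    \<open>?N\<^sup>2 / L\<close> pairs that a large \<open>B\<close> is known to contain.\<close>
  then have "4 * L * card X \<le> 4 * L * (?N * (g * d ^ g) + card hi * ?N)" by (rule mult_le_mono2)
  also have "\<dots> = ?N * (4 * L * g * d ^ g) + ?N * (4 * L * card hi)" by (simp add: algebra_simps)
  also have "\<dots> \<le> ?N * ?N + ?N * ?N" using N hi by (intro add_mono mult_le_mono2)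
  finally have "2 * L * card X \<le> ?N\<^sup>2" by (simp add: power2_eq_square)
  moreover have "card F \<le> card X" unfolding F_def by (rule card_image_le[OF finX])
  then have "2 * L * card F \<le> 2 * L * card X" by simp
  ultimately have F: "2 * L * card F \<le> ?N\<^sup>2" by linarith
  have finF: "finite F" unfolding F_def using finX by simp
  show thesis
  proof (rule that[of A])
    show "A \<subseteq> [V]\<^bsup>2\<^esup>" by (auto simp: A_def)
  next
    fix B assume B: "B \<subseteq> [V]\<^bsup>2\<^esup>" "?N\<^sup>2 \<le> L * card B"
    have "A \<inter> B = B - F" using B by (auto simp: A_def)
    then have "card B \<le> card (A \<inter> B) + card F"
      using finF diff_card_le_card_Diff[of F B] by simp
    then have "2 * L * card B \<le> 2 * L * (card (A \<inter> B) + card F)" by (rule mult_le_mono2)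
    then show "?N\<^sup>2 \<le> 2 * L * card (A \<inter> B)" using B(2) F by (simp add: distrib_left)
  next
    fix e v assume e: "e \<in> A"
    show "edge_degree (insert e E) v \<le> d"
    proof (cases "v \<in> e")
      case True
      then obtain w where w: "e = {v, w}" "v \<in> V" "w \<in> V"
        using e by (auto simp: A_def nsets_def card_2_iff)
      have "v \<notin> hi"
      proof
        assume "v \<in> hi"
        then have "(v, w) \<in> X" using w by (auto simp: X_def)
        then have "e \<in> F" unfolding F_def w by (metis (mono_tags) case_prod_conv image_eqI)
        then show False using e by (auto simp: A_def)
      qed
      then have "edge_degree E v < d" using deg[of v] w by (auto simp: hi_def)
      moreover have "{x \<in> insert e E. v \<in> x} = insert e {x \<in> E. v \<in> x}" using True by auto
      then have "edge_degree (insert e E) v \<le> Suc (edge_degree E v)"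
        unfolding edge_degree_def by (simp add: card_insert_le_m1 card_insert_if finE)
      ultimately show ?thesis by linarith
    next
      case False
      then have "{x \<in> insert e E. v \<in> x} = {x \<in> E. v \<in> x}" by auto
      then show ?thesis using deg[of v] by (simp add: edge_degree_def)
    qed
  next
    fix e p assume e: "e \<in> A" and p: "is_cycle (V, insert e E) p"
    show "g \<le> length p"
    proof (cases "is_cycle (V, E) p")
      case False
      with p obtain u v where uv: "e = {u, v}" "(u, v) \<in> adj_rel E ^^ (length p - 1)"
        by (rule cycle_new_edge_path)
      show ?thesis
      proof (rule ccontr)
        assume "\<not> g \<le> length p"
        moreover have "3 \<le> length p" using p by (simp add: is_cycle_def)
        \<comment> \<open>The walk from \<open>u\<close> to \<open>v\<close> has length
          \<open>length p - 1 < g\<close>, so \<open>e\<close> would have been discarded.\<close>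
        ultimately have "v \<in> close u" unfolding close_def using uv by auto
        moreover have "u \<in> V" using e uv by (auto simp: A_def nsets_def)
        ultimately have "(u, v) \<in> X" by (auto simp: X_def)
        then have "e \<in> F" unfolding F_def uv by (metis (mono_tags) case_prod_conv image_eqI)
        then show False using e by (auto simp: A_def)
      qed
    qed (rule girth)
  qed
qed

text \<open>Double counting of the pairs \<open>(e, B)\<close> with
  \<open>e \<in> A \<inter> B\<close>: every \<open>B\<close> has at least \<open>M / K\<close> of
  them, while \<open>A\<close> has at most \<open>M\<close> elements, so some \<open>e\<close> lies
  in at least a \<open>1 / K\<close> fraction of \<open>U\<close>. Positivity of \<open>M\<close>
  makes \<open>A\<close> nonempty, which the strict inequality of sums requires.\<close>

lemma averaging:
  assumes finA: "finite A" and finU: "finite U" and U: "U \<noteq> {}"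
    and cA: "card A \<le> M" and big: "\<And>B. B \<in> U \<Longrightarrow> M \<le> K * card (A \<inter> B)" and M: "M > 0"
  obtains e where "e \<in> A" "card U \<le> K * card {B \<in> U. e \<in> B}"
proof (rule ccontr)
  assume "\<not> thesis"
  with that have *: "K * card {B \<in> U. e \<in> B} < card U" if "e \<in> A" for e
    using \<open>e \<in> A\<close> by (meson not_le)
  have cU: "card U > 0" using finU U by (simp add: card_gt_0_iff)
  have "A \<noteq> {}"
  proof
    assume "A = {}"
    moreover obtain B where "B \<in> U" using U by blast
    ultimately show False using big[of B] M by simp
  qed
  have "card U * M \<le> (\<Sum>B\<in>U. K * card (A \<inter> B))"
    using big by (intro sum_bounded_below[of U M, simplified]) auto
  also have "\<dots> = K * (\<Sum>B\<in>U. card {e \<in> A. e \<in> B})"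
    by (simp add: sum_distrib_left Int_def)
  also have "(\<Sum>B\<in>U. card {e \<in> A. e \<in> B}) = (\<Sum>e\<in>A. card {B \<in> U. e \<in> B})"
    using sum_multicount_gen[OF finU finA, of "\<lambda>B e. e \<in> B"] by simp
  also have "K * \<dots> = (\<Sum>e\<in>A. K * card {B \<in> U. e \<in> B})" by (simp add: sum_distrib_left)
  also have "\<dots> < (\<Sum>e\<in>A. card U)"
    using * finA \<open>A \<noteq> {}\<close> by (intro sum_strict_mono) auto
  also have "\<dots> \<le> card U * M" using cA by simp
  finally show False by simp
qed

text \<open>Induction on the number of steps. By averaging over the allowed pairs, one new edge hits
  at least a \<open>1 / (2 * L)\<close> fraction of the sets not hit so far, so their number decays
  geometrically. The bound on \<open>m\<close> keeps the average degree low enough for allowed pairs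
  to remain plentiful.\<close>

lemma greedy_hitting_steps:
  fixes V :: "'a set"
  assumes V: "finite V" "V \<noteq> {}" and U: "finite U"
    and B: "\<And>B. B \<in> U \<Longrightarrow> B \<subseteq> [V]\<^bsup>2\<^esup> \<and> (card V)\<^sup>2 \<le> L * card B"
    and d: "d = 8 * C * L" and C: "C > 0" and L: "L > 0"
    and N: "4 * L * g * d ^ g \<le> card V"
    and m: "m \<le> C * card V"
  shows "\<exists>E \<subseteq> [V]\<^bsup>2\<^esup>. card E \<le> m \<and> (\<forall>v. edge_degree E v \<le> d) \<and>
           (\<forall>p. is_cycle (V, E) p \<longrightarrow> g \<le> length p) \<and>
           real (card {B \<in> U. E \<inter> B = {}}) \<le> real (card U) * (1 - 1 / real (2 * L)) ^ m"
  using m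
proof (induction m)
  case 0
  show ?case
    by (rule exI[of _ "{}"]) (fastforce simp: edge_degree_def is_cycle_def)
next
  case (Suc m)
  then obtain E where E: "E \<subseteq> [V]\<^bsup>2\<^esup>" "card E \<le> m" "\<And>v. edge_degree E v \<le> d"
    "\<And>p. is_cycle (V, E) p \<Longrightarrow> g \<le> length p"
    and cU: "real (card {B \<in> U. E \<inter> B = {}}) \<le> real (card U) * (1 - 1 / real (2 * L)) ^ m"
    by auto
  define W where "W = {B \<in> U. E \<inter> B = {}}"
  have finW: "finite W" using U by (simp add: W_def)
  have finE: "finite E" using V E finite_subset finite_imp_finite_nsets by metis
  show ?case
  proof (cases "W = {}")
    case True
    \<comment> \<open>Averaging needs a set that is not yet hit. If there is none, \<open>E\<close>
      is kept: \<open>card E\<close> is only bounded above, and the claimed bound is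
      nonnegative.\<close>
    then have z: "card {B \<in> U. E \<inter> B = {}} = 0" unfolding W_def by (metis card.empty)
    have "1 / real (2 * L) \<le> 1" using L by simp
    then have "0 \<le> real (card U) * (1 - 1 / real (2 * L)) ^ Suc m"
      by (intro mult_nonneg_nonneg zero_le_power) simp_all
    then show ?thesis
      using E
      by (intro exI[of _ E]) (auto simp del: power_Suc simp: z)
  next
    case False
    have "card E \<le> C * card V" using E(2) Suc.prems by simp
    from greedy_allowed_pairs[OF V(1) E(1) E(3) this d C L N E(4)]
    obtain A where A: "A \<subseteq> [V]\<^bsup>2\<^esup>"
      "\<And>B. B \<subseteq> [V]\<^bsup>2\<^esup> \<Longrightarrow> (card V)\<^sup>2 \<le> L * card B \<Longrightarrow> (card V)\<^sup>2 \<le> 2 * L * card (A \<inter> B)"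
      "\<And>e v. e \<in> A \<Longrightarrow> edge_degree (insert e E) v \<le> d"
      "\<And>e p. e \<in> A \<Longrightarrow> is_cycle (V, insert e E) p \<Longrightarrow> g \<le> length p" by metis
    have finA: "finite A" using A(1) V(1) finite_subset finite_imp_finite_nsets by metis
    have "card A \<le> card ([V]\<^bsup>2\<^esup>)"
      using A(1) V(1) by (intro card_mono finite_imp_finite_nsets)
    also have "\<dots> \<le> (card V)\<^sup>2"
      by (auto simp: card_nsets choose_two power2_eq_square intro: le_trans[OF div_le_dividend])
    finally have cA: "card A \<le> (card V)\<^sup>2" .
    have "(card V)\<^sup>2 > 0" using V by (simp add: card_gt_0_iff)
    moreover have "(card V)\<^sup>2 \<le> 2 * L * card (A \<inter> B)" if "B \<in> W" for B
      using that B[of B] by (intro A(2)) (auto simp: W_def)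
    ultimately obtain e where e: "e \<in> A" "card W \<le> 2 * L * card {B \<in> W. e \<in> B}"
      using averaging[OF finA finW False cA, of "2 * L"] by metis
    have eq: "{B \<in> U. insert e E \<inter> B = {}} = W - {B \<in> W. e \<in> B}" by (auto simp: W_def)
    have "real (card (W - {B \<in> W. e \<in> B})) = real (card W) - real (card {B \<in> W. e \<in> B})"
      using finW by (subst card_Diff_subset) (auto intro!: of_nat_diff card_mono)
    also have "\<dots> \<le> real (card W) * (1 - 1 / real (2 * L))"
    proof -
      have "real (card W) \<le> real (2 * L) * real (card {B \<in> W. e \<in> B})"
        using e(2) by (metis of_nat_mono of_nat_mult)
      then show ?thesis using L by (simp add: field_simps)
    qed
    also have "\<dots> \<le> real (card U) * (1 - 1 / real (2 * L)) ^ m * (1 - 1 / real (2 * L))"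
      using cU L by (intro mult_right_mono) (auto simp: W_def)
    finally have "real (card {B \<in> U. insert e E \<inter> B = {}}) \<le> real (card U) * (1 - 1 / real (2 * L)) ^ Suc m"
      unfolding eq by (simp add: mult_ac)
    moreover have "card (insert e E) \<le> Suc m" using E(2) finE by (simp add: card_insert_if)
    ultimately show ?thesis
      using A e(1) E(1) by (intro exI[of _ "insert e E"]) auto
  qed
qed

text \<open>With \<open>C\<close> chosen so that \<open>4 * q ^ C < 1\<close>, fewer than
  \<open>(4 * q ^ C) ^ card V < 1\<close> sets remain after \<open>C * card V\<close> greedy steps,
  hence none.\<close>

lemma large_girth_hitting:
  assumes L: "L > 0"
  obtains N0 where "\<And>(V :: 'a set) U. finite V \<Longrightarrow> N0 \<le> card V \<Longrightarrow> finite U \<Longrightarrow> card U \<le> 4 ^ card V \<Longrightarrow>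
      (\<And>B. B \<in> U \<Longrightarrow> B \<subseteq> [V]\<^bsup>2\<^esup> \<and> (card V)\<^sup>2 \<le> L * card B) \<Longrightarrow>
      \<exists>E \<subseteq> [V]\<^bsup>2\<^esup>. (\<forall>p. is_cycle (V, E) p \<longrightarrow> g \<le> length p) \<and> (\<forall>B\<in>U. E \<inter> B \<noteq> {})"
proof -
  define q where "q = 1 - 1 / real (2 * L)"
  have q: "0 \<le> q" "q < 1" using L by (auto simp: q_def)
  obtain C where C: "q ^ C < 1 / 4" using real_arch_pow_inv[of "1/4" q] q by auto
  then have Cpos: "C > 0" by (cases C) auto
  define d where "d = 8 * C * L"
  show thesis
  \<comment> \<open>The threshold depends on \<open>L\<close> and \<open>g\<close> alone, as
    \<open>C\<close> and \<open>d\<close> are determined by \<open>L\<close>. The summand 1 makes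
    \<open>V\<close> nonempty, so that the power in the final estimate is strictly below 1.\<close>
  proof (rule that[of "4 * L * g * d ^ g + 1"])
    fix V :: "'a set" and U
    assume V: "finite V" "4 * L * g * d ^ g + 1 \<le> card V" and U: "finite U" "card U \<le> 4 ^ card V"
      and B: "\<And>B. B \<in> U \<Longrightarrow> B \<subseteq> [V]\<^bsup>2\<^esup> \<and> (card V)\<^sup>2 \<le> L * card B"
    have V0: "V \<noteq> {}" and N: "4 * L * g * d ^ g \<le> card V" using V(2) by auto
    obtain E where E: "E \<subseteq> [V]\<^bsup>2\<^esup>" "\<forall>p. is_cycle (V, E) p \<longrightarrow> g \<le> length p"
      "real (card {B \<in> U. E \<inter> B = {}}) \<le> real (card U) * q ^ (C * card V)"
      using greedy_hitting_steps[OF V(1) V0 U(1) B d_def Cpos L N order_refl]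
      unfolding q_def by blast
    have "real (card U) \<le> 4 ^ card V" using U(2) by (metis of_nat_le_iff of_nat_numeral of_nat_power)
    then have "real (card U) * q ^ (C * card V) \<le> 4 ^ card V * (q ^ C) ^ card V"
      using q by (simp add: power_mult mult_right_mono)
    also have "\<dots> = (4 * q ^ C) ^ card V" by (simp add: power_mult_distrib)
    also have "\<dots> < 1" using C q V V0 by (intro power_less_one_iff[THEN iffD2]) (auto simp: card_gt_0_iff)
    finally have "card {B \<in> U. E \<inter> B = {}} = 0" using E(3) by linarith
    then have "\<forall>B\<in>U. E \<inter> B \<noteq> {}" using U(1) by auto
    with E show "\<exists>E \<subseteq> [V]\<^bsup>2\<^esup>. (\<forall>p. is_cycle (V, E) p \<longrightarrow> g \<le> length p) \<and> (\<forall>B\<in>U. E \<inter> B \<noteq> {})"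
      by blast
  qed
qed

section \<open>The sparse \<open>k\<close>-partite graph\<close>

lemma div_eq_iff_interval: "0 < n \<Longrightarrow> v div n = i \<longleftrightarrow> v \<in> {i * n..<Suc i * n}" for v n i :: nat
  by (metis atLeastLessThan_iff div_nat_eqI div_times_less_eq_dividend dividend_less_times_div
      mult.commute mult_Suc add.commute)

lemma pigeonhole_fiber:
  assumes "finite A" "f \<in> A \<rightarrow> {..<l}" "l > 0"
  obtains a where "a < (l::nat)" "card A \<le> l * card {v \<in> A. f v = a}"
proof -
  obtain a where "a \<in> {..<l}" "card (f -` {a} \<inter> A) * card {..<l} \<ge> card A"
    using pigeonhole_card[OF assms(2,1)] assms(3) by blast
  moreover have "f -` {a} \<inter> A = {v \<in> A. f v = a}" by auto
  ultimately show thesis using that by (simp add: mult.commute)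
qed

text \<open>The vertices form \<open>k\<close> blocks of size \<open>n\<close>, and the edges hit
  every join of two sets of size at least \<open>n / l\<close> in different blocks. In each block
  some color \<open>a i\<close> is taken by at least \<open>n / l\<close> vertices, and these
  classes are joined by edges. Nothing makes \<open>a\<close> injective here; its users derive that
  from properness.\<close>

lemma sparse_graph_exists:
  fixes k l g :: nat
  assumes k: "k > 0" and l: "l > 0"
  obtains G :: "nat ugraph" and \<kappa> where "fin_ugraph G" "proper_coloring G k \<kappa>" "enat g \<le> girth G"
    "\<And>f. f \<in> verts G \<rightarrow> {..<l} \<Longrightarrow> \<exists>a. a ` {..<k} \<subseteq> f ` verts G \<and>
       (\<forall>i<k. \<forall>j<k. i \<noteq> j \<longrightarrow> (\<exists>u v. {u, v} \<in> edges G \<and> f u = a i \<and> f v = a j))"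
proof -
  \<comment> \<open>A join has at least \<open>(n / l)\<^sup>2\<close> edges and
    \<open>card V = k * n\<close>, so this \<open>L\<close> gives the density bound that the hitting
    lemma asks for.\<close>
  define L where "L = k\<^sup>2 * l\<^sup>2"
  have L: "L > 0" using k l by (simp add: L_def)
  obtain N0 where N0: "\<And>(V :: nat set) U. finite V \<Longrightarrow> N0 \<le> card V \<Longrightarrow> finite U \<Longrightarrow> card U \<le> 4 ^ card V \<Longrightarrow>
      (\<And>B. B \<in> U \<Longrightarrow> B \<subseteq> [V]\<^bsup>2\<^esup> \<and> (card V)\<^sup>2 \<le> L * card B) \<Longrightarrow>
      \<exists>E \<subseteq> [V]\<^bsup>2\<^esup>. (\<forall>p. is_cycle (V, E) p \<longrightarrow> g \<le> length p) \<and> (\<forall>B\<in>U. E \<inter> B \<noteq> {})"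
    using large_girth_hitting[OF L] by metis
  define n where "n = Suc N0"
  define V where "V = {..<k * n}"
  define P where "P = (\<lambda>i. {v \<in> V. v div n = i})"
  have n: "n > 0" by (simp add: n_def)
  have finV: "finite V" and cV: "card V = k * n" by (auto simp: V_def)
  have P: "P i \<subseteq> V" for i by (auto simp: P_def)
  have cP: "card (P i) = n" if "i < k" for i
  proof -
    have "Suc i * n \<le> k * n" using that by (intro mult_le_mono1) simp
    then have "P i = {i * n..<Suc i * n}"
      unfolding P_def V_def div_eq_iff_interval[OF n] by auto
    then show ?thesis by simp
  qed
  define join where "join = (\<lambda>(S, T). (\<lambda>(s, t). {s, t}) ` (S \<times> T) :: nat set set)"
  define Q where "Q = {(S, T). \<exists>i<k. \<exists>j<k. i \<noteq> j \<and> S \<subseteq> P i \<and> T \<subseteq> P j \<and> n \<le> l * card S \<and> n \<le> l * card T}"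
  have QV: "Q \<subseteq> Pow V \<times> Pow V" using P by (auto simp: Q_def)
  have finQ: "finite Q" using QV finV by (meson finite_Pow_iff finite_SigmaI finite_subset)
  have "card (join ` Q) \<le> card Q" using finQ by (rule card_image_le)
  also have "\<dots> \<le> card (Pow V \<times> Pow V)" using QV finV by (intro card_mono) auto
  \<comment> \<open>A join is determined by two subsets of \<open>V\<close>, which leaves at most
    \<open>2 ^ card V * 2 ^ card V\<close> of them.\<close>
  also have "\<dots> = 4 ^ card V"
    by (simp add: card_cartesian_product card_Pow[OF finV] flip: power_mult_distrib)
  finally have cQ: "card (join ` Q) \<le> 4 ^ card V" .
  have big: "B \<subseteq> [V]\<^bsup>2\<^esup> \<and> (card V)\<^sup>2 \<le> L * card B" if B_in: "B \<in> join ` Q" for B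
  proof -
    obtain S T i j where B: "B = join (S, T)" and ij: "i \<noteq> j" "S \<subseteq> P i" "T \<subseteq> P j"
      and c: "n \<le> l * card S" "n \<le> l * card T"
      using B_in by (auto simp: Q_def)
    have disj: "s \<noteq> t" "s \<notin> T" "t \<notin> S" if "s \<in> S" "t \<in> T" for s t
      using that ij by (auto simp: P_def)
    \<comment> \<open>Different blocks are disjoint, so an unordered pair reveals which end lies in
      \<open>S\<close>.\<close>
    have "inj_on (\<lambda>(s, t). {s, t}) (S \<times> T)"
    proof (rule inj_onI)
      fix x y assume "x \<in> S \<times> T" "y \<in> S \<times> T" "(\<lambda>(s, t). {s, t}) x = (\<lambda>(s, t). {s, t}) y"
      moreover obtain s t s' t' where "x = (s, t)" "y = (s', t')" by (cases x, cases y)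
      ultimately have "s \<in> S" "t' \<in> T" "{s, t} = {s', t'}" "x = (s, t)" "y = (s', t')" by auto
      then show "x = y" using disj(1)[of s t'] by (auto simp: doubleton_eq_iff)
    qed
    then have "card B = card S * card T"
      unfolding B join_def by (simp add: card_image card_cartesian_product)
    moreover have "n * n \<le> (l * card S) * (l * card T)" using c by (rule mult_le_mono)
    then have "k\<^sup>2 * (n * n) \<le> k\<^sup>2 * ((l * card S) * (l * card T))" by (rule mult_le_mono2)
    ultimately have "(card V)\<^sup>2 \<le> L * card B"
      by (simp add: cV L_def power2_eq_square mult_ac)
    moreover have "B \<subseteq> [V]\<^bsup>2\<^esup>"
    proof
      fix e assume "e \<in> B"
      then obtain s t where "e = {s, t}" "s \<in> S" "t \<in> T" by (auto simp: B join_def)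
      then show "e \<in> [V]\<^bsup>2\<^esup>"
        using disj(1)[of s t] ij P[of i] P[of j] by (auto simp: nsets_def card_insert_if)
    qed
    ultimately show ?thesis by blast
  qed
  have "N0 \<le> card V" using k by (cases k) (auto simp: cV n_def)
  then have "\<exists>E \<subseteq> [V]\<^bsup>2\<^esup>. (\<forall>p. is_cycle (V, E) p \<longrightarrow> g \<le> length p) \<and> (\<forall>B\<in>join ` Q. E \<inter> B \<noteq> {})"
    by (rule N0[OF finV _ finite_imageI[OF finQ] cQ big])
  then obtain E where E: "E \<subseteq> [V]\<^bsup>2\<^esup>" "\<forall>p. is_cycle (V, E) p \<longrightarrow> g \<le> length p"
    "\<forall>B\<in>join ` Q. E \<inter> B \<noteq> {}"
    by (elim exE conjE)
  \<comment> \<open>Edges in no join are dropped. Every remaining edge runs between two blocks, no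
    cycle is created, and each join is still hit.\<close>
  define G where "G = (V, E \<inter> \<Union>(join ` Q))"
  show thesis
  proof (rule that[of G "\<lambda>v. v div n"])
    show "fin_ugraph G" using finV E by (auto simp: fin_ugraph_def G_def)
    have "v div n < k" if "v \<in> V" for v
      using that n by (simp add: V_def less_mult_imp_div_less)
    moreover have "u div n \<noteq> v div n" if uv: "{u, v} \<in> edges G" for u v
    proof -
      obtain S T s t i j where "i \<noteq> j" "S \<subseteq> P i" "T \<subseteq> P j" "s \<in> S" "t \<in> T" "{u, v} = {s, t}"
        using uv by (auto simp: G_def Q_def join_def)
      moreover from this have "s div n = i" "t div n = j" by (auto simp: P_def)
      ultimately show ?thesis by (auto simp: doubleton_eq_iff)
    qed
    ultimately show "proper_coloring G k (\<lambda>v. v div n)"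
      by (auto simp: proper_coloring_def G_def)
    show "enat g \<le> girth G"
      using E(2) is_cycle_mono[of V "E \<inter> \<Union>(join ` Q)" _ E] by (auto simp: enat_le_girth_iff G_def)
  next
    fix f assume f: "f \<in> verts G \<rightarrow> {..<l}"
    have "\<exists>a. n \<le> l * card {v \<in> P i. f v = a}" if "i < k" for i
    proof -
      have "f \<in> P i \<rightarrow> {..<l}" using f P by (auto simp: G_def)
      moreover have "finite (P i)" using P finV finite_subset by blast
      ultimately show ?thesis using pigeonhole_fiber[of "P i" f l] l cP[OF that] by metis
    qed
    then obtain a where a: "\<And>i. i < k \<Longrightarrow> n \<le> l * card {v \<in> P i. f v = a i}" by metis
    show "\<exists>a. a ` {..<k} \<subseteq> f ` verts G \<and>
       (\<forall>i<k. \<forall>j<k. i \<noteq> j \<longrightarrow> (\<exists>u v. {u, v} \<in> edges G \<and> f u = a i \<and> f v = a j))"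
    proof (intro exI[of _ a] conjI allI impI subsetI)
      fix x assume "x \<in> a ` {..<k}"
      then obtain i where i: "i < k" "x = a i" by auto
      have "{v \<in> P i. f v = a i} \<noteq> {}" using a[OF i(1)] n by (metis card.empty mult_0_right not_le)
      then show "x \<in> f ` verts G" using i P[of i] by (force simp: G_def)
    next
      fix i j assume ij: "i < k" "j < k" "i \<noteq> j"
      let ?J = "join ({v \<in> P i. f v = a i}, {v \<in> P j. f v = a j})"
      have "({v \<in> P i. f v = a i}, {v \<in> P j. f v = a j}) \<in> Q"
        unfolding Q_def using ij a[of i] a[of j] by auto
      then have J: "?J \<in> join ` Q" by (rule imageI)
      with E(3) have "E \<inter> ?J \<noteq> {}" by (rule bspec)
      then obtain e where e: "e \<in> E" "e \<in> ?J" by blast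
      from e(2) obtain u v where uv: "e = {u, v}" "f u = a i" "f v = a j" by (auto simp: join_def)
      have "e \<in> edges G" unfolding G_def snd_conv using e J by blast
      then show "\<exists>u v. {u, v} \<in> edges G \<and> f u = a i \<and> f v = a j"
        using uv by blast
    qed
  qed
qed

section \<open>The lower bound through Ramsey colorings of cliques\<close>

text \<open>A copy of a clique in a clique is just an injection of indices; both bounds use arrowing
  in this form.\<close>

lemma arrows_complete_iff:
  "arrows (complete_ugraph {..<N :: nat}) (complete_ugraph {..<k :: nat}) \<longleftrightarrow>
     (\<forall>c :: nat set \<Rightarrow> bool. \<exists>a b. inj_on a {..<k} \<and> a ` {..<k} \<subseteq> {..<N} \<and>
        (\<forall>i<k. \<forall>j<k. i \<noteq> j \<longrightarrow> c {a i, a j} = b))"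
proof -
  have "is_copy (complete_ugraph {..<k}) (complete_ugraph {..<N}) a \<and>
          (\<forall>e \<in> edges (complete_ugraph {..<k}). c (a ` e) = b) \<longleftrightarrow>
        inj_on a {..<k} \<and> a ` {..<k} \<subseteq> {..<N} \<and> (\<forall>i<k. \<forall>j<k. i \<noteq> j \<longrightarrow> c {a i, a j} = b)"
    for a :: "nat \<Rightarrow> nat" and b and c :: "nat set \<Rightarrow> bool"
  proof -
    have ball_edges: "(\<forall>e \<in> [{..<k}]\<^bsup>2\<^esup>. P e) \<longleftrightarrow> (\<forall>i<k. \<forall>j<k. i \<noteq> j \<longrightarrow> P {i, j})" for P
    proof -
      have "e \<in> [{..<k}]\<^bsup>2\<^esup> \<longleftrightarrow> (\<exists>i<k. \<exists>j<k. i \<noteq> j \<and> e = {i, j})" for e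
        by (auto simp: nsets_def card_2_iff)
      then show ?thesis by metis
    qed
    have "{a i, a j} \<in> [{..<N}]\<^bsup>2\<^esup>"
      if "inj_on a {..<k}" "a ` {..<k} \<subseteq> {..<N}" "i < k" "j < k" "i \<noteq> j" for i j
      using that by (auto simp: nsets_def card_insert_if dest: inj_onD)
    then show ?thesis
      unfolding is_copy_def complete_ugraph_def fst_conv snd_conv ball_edges image_insert image_empty
      by blast
  qed
  then show ?thesis unfolding arrows_def by (simp only:)
qed

lemma chromatic_number_coloring:
  assumes "fin_ugraph G"
  obtains c where "proper_coloring G (chromatic_number G) c"
  using LeastI_ex[of "\<lambda>m. \<exists>c. proper_coloring G m c"] proper_coloring_exists[OF assms]
  unfolding chromatic_number_def by blast

lemma chromatic_number_eqI:
  assumes "proper_coloring G m c" "\<And>j c. proper_coloring G j c \<Longrightarrow> m \<le> j"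
  shows "chromatic_number G = m"
  unfolding chromatic_number_def using assms by (intro Least_equality) blast+

lemma ramsey_number_arrows: "arrows (complete_ugraph {..<ramsey_number k}) (complete_ugraph {..<k})"
  unfolding ramsey_number_def by (rule LeastI_ex) (rule arrows_complete_exists)

text \<open>A monochromatic copy \<open>h\<close> of \<open>G\<close> under the pulled-back coloring
  makes \<open>col \<circ> h\<close> a vertex coloring of \<open>G\<close>. Its \<open>k\<close>
  pairwise joined classes would span a monochromatic clique in the coloring \<open>c\<close> that
  has none.\<close>

lemma chromatic_number_ge_ramsey_number:
  fixes F :: "'b ugraph" and G :: "'a ugraph"
  assumes F: "fin_ugraph F" and FG: "arrows F G"
    and G: "\<And>f. f \<in> verts G \<rightarrow> {..<ramsey_number k} \<Longrightarrow> \<exists>a. a ` {..<k} \<subseteq> f ` verts G \<and>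
       (\<forall>i<k. \<forall>j<k. i \<noteq> j \<longrightarrow> (\<exists>u v. {u, v} \<in> edges G \<and> f u = a i \<and> f v = a j))"
  shows "ramsey_number k \<le> chromatic_number F"
proof (rule ccontr)
  define m where "m = chromatic_number F"
  assume "\<not> ramsey_number k \<le> chromatic_number F"
  then have m: "m < ramsey_number k" by (simp add: m_def)
  then have "\<not> arrows (complete_ugraph {..<m}) (complete_ugraph {..<k})"
    unfolding ramsey_number_def by (rule not_less_Least)
  then obtain c :: "nat set \<Rightarrow> bool" where c: "\<not> (\<exists>a b. inj_on a {..<k} \<and> a ` {..<k} \<subseteq> {..<m} \<and>
      (\<forall>i<k. \<forall>j<k. i \<noteq> j \<longrightarrow> c {a i, a j} = b))"
    unfolding arrows_complete_iff not_all by (elim exE)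
  obtain col where col: "proper_coloring F m col"
    using chromatic_number_coloring[OF F] by (auto simp: m_def)
  obtain h b where h: "is_copy G F h" "\<forall>e\<in>edges G. c (col ` (h ` e)) = b"
    using FG[unfolded arrows_def, rule_format, of "\<lambda>e. c (col ` e)"] by blast
  have sub: "(col \<circ> h) ` verts G \<subseteq> {..<m}"
    using h(1) col by (auto simp: is_copy_def proper_coloring_def)
  \<comment> \<open>Fewer than \<open>ramsey_number k\<close> colors are used, so the hypothesis on
    \<open>G\<close> applies.\<close>
  then have "col \<circ> h \<in> verts G \<rightarrow> {..<ramsey_number k}"
    using m by fastforce
  from G[OF this] obtain a where a: "a ` {..<k} \<subseteq> (col \<circ> h) ` verts G"
    "\<forall>i<k. \<forall>j<k. i \<noteq> j \<longrightarrow> (\<exists>u v. {u, v} \<in> edges G \<and> (col \<circ> h) u = a i \<and> (col \<circ> h) v = a j)"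
    by (elim exE conjE)
  \<comment> \<open>The colors \<open>a i\<close> differ because \<open>col\<close> is proper on
    \<open>F\<close> and \<open>h\<close> maps the joining edge to an edge of
    \<open>F\<close>.\<close>
  have pair: "a i \<noteq> a j \<and> c {a i, a j} = b" if ij: "i < k" "j < k" "i \<noteq> j" for i j
  proof -
    obtain u v where uv: "{u, v} \<in> edges G" "col (h u) = a i" "col (h v) = a j"
      using a(2)[rule_format, OF ij] unfolding comp_def by blast
    have "{h u, h v} \<in> edges F" using h(1) uv(1) by (force simp: is_copy_def)
    then have "a i \<noteq> a j" using col uv(2,3) unfolding proper_coloring_def by metis
    moreover have "c {a i, a j} = b" using bspec[OF h(2) uv(1)] uv by simp
    ultimately show ?thesis by blast
  qed
  have "inj_on a {..<k}" using pair by (meson inj_onI lessThan_iff)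
  moreover have "a ` {..<k} \<subseteq> {..<m}" using a(1) sub by blast
  moreover have "\<forall>i<k. \<forall>j<k. i \<noteq> j \<longrightarrow> c {a i, a j} = b" using pair by simp
  ultimately show False by - (rule notE[OF c], intro exI conjI)
qed

section \<open>Bipartite and multipartite Ramsey theorems\<close>

text \<open>Symmetry of \<open>c\<close> is not assumed; an edge coloring enters as
  \<open>\<lambda>u v. c {u, v}\<close>.\<close>

definition homogeneous :: "('a \<Rightarrow> 'a \<Rightarrow> bool) \<Rightarrow> 'a set \<Rightarrow> 'a set \<Rightarrow> bool" where
  "homogeneous c S T \<longleftrightarrow> (\<exists>b. \<forall>s\<in>S. \<forall>t\<in>T. c s t = b)"

lemma homogeneous_subset: "homogeneous c S T \<Longrightarrow> S' \<subseteq> S \<Longrightarrow> T' \<subseteq> T \<Longrightarrow> homogeneous c S' T'"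
  unfolding homogeneous_def by (meson subsetD)

text \<open>Fix \<open>2 * t\<close> vertices of \<open>A\<close>. The vertices of \<open>B\<close>
  show at most \<open>2 ^ (2 * t)\<close> color patterns on them, so \<open>t\<close> vertices share
  a pattern \<open>X\<close>; one of the two colors of this pattern occurs at least \<open>t\<close>
  times.\<close>

lemma bipartite_ramsey:
  assumes A: "finite A" "2 * t \<le> card A" and B: "finite B" "t * 2 ^ (2 * t) \<le> card B"
  obtains S T where "S \<subseteq> A" "T \<subseteq> B" "t \<le> card S" "t \<le> card T" "homogeneous c S T"
proof -
  obtain A0 where A0: "A0 \<subseteq> A" "card A0 = 2 * t" "finite A0"
    using obtain_subset_with_card_n[OF A(2)] by metis
  define f where "f = (\<lambda>y. {x \<in> A0. c x y})"
  have "f \<in> B \<rightarrow> Pow A0" by (auto simp: f_def)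
  then obtain X where X: "X \<in> Pow A0" "card B \<le> card (f -` {X} \<inter> B) * card (Pow A0)"
    using pigeonhole_card[of f B "Pow A0"] B(1) A0(3) by blast
  define T where "T = f -` {X} \<inter> B"
  have "t * 2 ^ (2 * t) \<le> card T * 2 ^ (2 * t)"
    using le_trans[OF B(2) X(2)] A0 by (simp add: T_def card_Pow)
  then have T: "t \<le> card T" by simp
  have TB: "T \<subseteq> B" by (auto simp: T_def)
  have hom: "homogeneous c X T" "homogeneous c (A0 - X) T"
    unfolding homogeneous_def T_def f_def by auto
  have "card A0 = card X + card (A0 - X)"
    using X(1) A0(3) by (metis Pow_iff card_Diff_subset card_mono finite_subset le_add_diff_inverse)
  then have "t \<le> card X \<or> t \<le> card (A0 - X)" using A0(2) by linarith
  then show thesis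
    using that[of X T] that[of "A0 - X" T] hom T TB X(1) A0(1) by blast
qed

text \<open>The pairs in \<open>D\<close> are treated one at a time. Shrinking sets preserves
  homogeneity, so pairs handled earlier are not spoiled; it only costs size, which is why
  \<open>t\<close> is generalized in the induction.\<close>

lemma multipartite_ramsey:
  fixes D :: "('i \<times> 'i) set"
  assumes "finite D" "\<And>i. (i, i) \<notin> D"
  shows "\<exists>M. \<forall>(W :: 'i \<Rightarrow> 'a set) c. (\<forall>i. finite (W i) \<and> M \<le> card (W i)) \<longrightarrow>
           (\<exists>W'. \<forall>i. W' i \<subseteq> W i \<and> t \<le> card (W' i) \<and> (\<forall>j. (i, j) \<in> D \<longrightarrow> homogeneous c (W' i) (W' j)))"
  using assms
proof (induction D arbitrary: t rule: finite_induct)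
  case empty
  then show ?case by blast
next
  case (insert p D)
  obtain x y where p: "p = (x, y)" by (cases p)
  with insert.prems have xy: "x \<noteq> y" by blast
  \<comment> \<open>Large enough for all three needs: \<open>t\<close> for the untouched sets,
    \<open>2 * t\<close> at \<open>x\<close> and \<open>t * 2 ^ (2 * t)\<close> at
    \<open>y\<close>.\<close>
  define s where "s = t + 2 * t + t * 2 ^ (2 * t)"
  obtain M where M: "\<And>(W :: 'i \<Rightarrow> 'a set) c. (\<forall>i. finite (W i) \<and> M \<le> card (W i)) \<Longrightarrow>
      \<exists>W'. \<forall>i. W' i \<subseteq> W i \<and> s \<le> card (W' i) \<and> (\<forall>j. (i, j) \<in> D \<longrightarrow> homogeneous c (W' i) (W' j))"
    using insert.IH[of s] insert.prems by blast
  show ?case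
  proof (intro exI[of _ M] allI impI)
    fix W :: "'i \<Rightarrow> 'a set" and c
    assume W: "\<forall>i. finite (W i) \<and> M \<le> card (W i)"
    then obtain W' where W': "\<And>i. W' i \<subseteq> W i" "\<And>i. s \<le> card (W' i)"
      "\<And>i j. (i, j) \<in> D \<Longrightarrow> homogeneous c (W' i) (W' j)" using M by metis
    have fin: "finite (W' i)" for i using W W'(1) finite_subset by metis
    have "2 * t \<le> card (W' x)" "t * 2 ^ (2 * t) \<le> card (W' y)"
      using W'(2)[of x] W'(2)[of y] by (auto simp: s_def)
    then obtain S T where ST: "S \<subseteq> W' x" "T \<subseteq> W' y" "t \<le> card S" "t \<le> card T" "homogeneous c S T"
      using bipartite_ramsey[OF fin _ fin] by metis
    define W'' where "W'' = W'(x := S, y := T)"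
    have sub: "W'' i \<subseteq> W' i" for i using ST by (auto simp: W''_def)
    have "W'' i \<subseteq> W i" for i using sub W'(1) by (rule subset_trans)
    moreover have "t \<le> card (W'' i)" for i using ST W'(2)[of i] by (auto simp: W''_def s_def)
    moreover have "homogeneous c (W'' i) (W'' j)" if "(i, j) \<in> insert p D" for i j
    proof (cases "(i, j) = p")
      case True
      then show ?thesis using p xy ST(5) by (auto simp: W''_def)
    next
      case False
      then have "(i, j) \<in> D" using that by simp
      from homogeneous_subset[OF W'(3)[OF this] sub sub] show ?thesis .
    qed
    ultimately show "\<exists>W'. \<forall>i. W' i \<subseteq> W i \<and> t \<le> card (W' i) \<and>
        (\<forall>j. (i, j) \<in> insert p D \<longrightarrow> homogeneous c (W' i) (W' j))"
      by (intro exI[of _ W''] allI conjI impI)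
  qed
qed

section \<open>The upper bound through complete multipartite graphs\<close>

text \<open>The parts are blocks of \<open>n\<close> consecutive integers, so for
  \<open>n > 0\<close> the part of \<open>v\<close> is \<open>v div n\<close>.\<close>

definition complete_multipartite :: "nat \<Rightarrow> nat \<Rightarrow> nat ugraph" where
  "complete_multipartite r n =
     ({..<r * n}, {{u, v} | u v. u < r * n \<and> v < r * n \<and> u div n \<noteq> v div n})"

lemma edges_complete_multipartite:
  "u < r * n \<Longrightarrow> v < r * n \<Longrightarrow> u div n \<noteq> v div n \<Longrightarrow> {u, v} \<in> edges (complete_multipartite r n)"
  unfolding complete_multipartite_def by auto

lemma fin_complete_multipartite: "fin_ugraph (complete_multipartite r n)"
proof -
  have "{u, v} \<in> [{..<r * n}]\<^bsup>2\<^esup>" if "u < r * n" "v < r * n" "u div n \<noteq> v div n" for u v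
  proof -
    have "u \<noteq> v" using that(3) by blast
    then show ?thesis using that(1,2) by (simp add: nsets_def)
  qed
  then show ?thesis unfolding fin_ugraph_def complete_multipartite_def by auto
qed

text \<open>The first vertices \<open>i * n\<close> of the parts form a clique, and the part index
  is a proper coloring.\<close>

lemma chromatic_number_complete_multipartite:
  assumes n: "n > 0"
  shows "chromatic_number (complete_multipartite r n) = r"
proof (rule chromatic_number_eqI)
  show "proper_coloring (complete_multipartite r n) r (\<lambda>v. v div n)"
    by (auto simp: proper_coloring_def complete_multipartite_def less_mult_imp_div_less doubleton_eq_iff)
next
  fix j c assume c: "proper_coloring (complete_multipartite r n) j c"
  have "inj_on (\<lambda>i. c (i * n)) {..<r}"
  proof (rule inj_onI, rule ccontr)
    fix x y assume xy: "x \<in> {..<r}" "y \<in> {..<r}" "c (x * n) = c (y * n)" "x \<noteq> y"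
    then have "{x * n, y * n} \<in> edges (complete_multipartite r n)"
      using n by (intro edges_complete_multipartite) simp_all
    then show False using c xy(3) by (auto simp: proper_coloring_def)
  qed
  moreover have "(\<lambda>i. c (i * n)) ` {..<r} \<subseteq> {..<j}"
    using c n by (auto simp: proper_coloring_def complete_multipartite_def Pi_def)
  ultimately show "r \<le> j" using card_inj_on_le[of _ "{..<r}" "{..<j}"] by auto
qed

text \<open>Once all pairs of parts are homogeneous, their colors form an edge coloring of the
  clique on \<open>r\<close> vertices. A monochromatic clique in it selects \<open>k\<close> parts,
  and the classes of \<kappa> are embedded one into each.\<close>

lemma complete_multipartite_arrows:
  fixes G :: "'a ugraph"
  assumes G: "fin_ugraph G" and \<kappa>: "proper_coloring G k \<kappa>"
    and r: "arrows (complete_ugraph {..<r}) (complete_ugraph {..<k})"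
  obtains n where "n > 0" "arrows (complete_multipartite r n) G"
proof -
  \<comment> \<open>Each shrunken part can hold all of \<open>G\<close>, so no class of \<kappa> is
    too large for it.\<close>
  define t where "t = card (verts G)"
  define D where "D = {(i, j). i < r \<and> j < r \<and> i \<noteq> j}"
  have "finite D" by (rule finite_subset[of _ "{..<r} \<times> {..<r}"]) (auto simp: D_def)
  moreover have "(i, i) \<notin> D" for i by (simp add: D_def)
  ultimately obtain M where M: "\<And>(W :: nat \<Rightarrow> nat set) c. (\<forall>i. finite (W i) \<and> M \<le> card (W i)) \<Longrightarrow>
      \<exists>W'. \<forall>i. W' i \<subseteq> W i \<and> t \<le> card (W' i) \<and> (\<forall>j. (i, j) \<in> D \<longrightarrow> homogeneous c (W' i) (W' j))"
    using multipartite_ramsey[of D t, where 'a = nat] by blast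
  define n where "n = Suc M"
  have n: "n > 0" by (simp add: n_def)
  have "\<exists>f b. is_copy G (complete_multipartite r n) f \<and> (\<forall>e\<in>edges G. c (f ` e) = b)"
    for c :: "nat set \<Rightarrow> bool"
  proof -
    define W where "W = (\<lambda>i. {i * n..<Suc i * n})"
    have "finite (W i) \<and> M \<le> card (W i)" for i by (auto simp: W_def n_def)
    then obtain W' where W': "\<And>i. W' i \<subseteq> W i" "\<And>i. t \<le> card (W' i)"
      "\<And>i j. (i, j) \<in> D \<Longrightarrow> homogeneous (\<lambda>u v. c {u, v}) (W' i) (W' j)"
      using M[of W "\<lambda>u v. c {u, v}"] by metis
    have divW: "v div n = i" if "v \<in> W' i" for v i
      using that W'(1)[of i] div_eq_iff_interval[OF n, of v i] by (auto simp: W_def)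
    obtain \<beta> where \<beta>: "\<And>i j u v. (i, j) \<in> D \<Longrightarrow> u \<in> W' i \<Longrightarrow> v \<in> W' j \<Longrightarrow> c {u, v} = \<beta> i j"
      using W'(3) unfolding homogeneous_def by metis
    \<comment> \<open>\<open>Min\<close> and \<open>Max\<close> pick one order of each pair of
      parts. When both parts contain vertices the choice is immaterial, since
      \<open>{u, v} = {v, u}\<close>.\<close>
    define c' where "c' = (\<lambda>e. \<beta> (Min e) (Max e))"
    obtain a b where a: "inj_on a {..<k}" "a ` {..<k} \<subseteq> {..<r}"
      "\<And>i j. i < k \<Longrightarrow> j < k \<Longrightarrow> i \<noteq> j \<Longrightarrow> c' {a i, a j} = b"
      using r unfolding arrows_complete_iff by metis
    have mono: "c {u, v} = b" if "i < k" "j < k" "i \<noteq> j" "u \<in> W' (a i)" "v \<in> W' (a j)" for i j u v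
    proof -
      have neq: "a i \<noteq> a j" using that a(1) by (auto dest: inj_onD)
      moreover have "a i < r" "a j < r" using that a(2) by auto
      ultimately have "(a i, a j) \<in> D" "(a j, a i) \<in> D" by (auto simp: D_def)
      then have "c {u, v} = \<beta> (a i) (a j)" "c {v, u} = \<beta> (a j) (a i)" using \<beta> that by auto
      moreover have "\<beta> (min (a i) (a j)) (max (a i) (a j)) = b"
        using a(3)[OF that(1-3)] by (simp add: c'_def)
      ultimately show ?thesis by (auto simp: min_def max_def insert_commute split: if_splits)
    qed
    have "\<exists>h. h ` verts G \<subseteq> W' i \<and> inj_on h (verts G)" for i
    proof (rule card_le_inj)
      show "finite (verts G)" using G by (simp add: fin_ugraph_def)
      show "finite (W' i)" using finite_subset[OF W'(1)[of i]] by (simp add: W_def)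
      show "card (verts G) \<le> card (W' i)" using W'(2) by (simp add: t_def)
    qed
    then obtain h where h: "\<And>i. inj_on (h i) (verts G)" "\<And>i. h i ` verts G \<subseteq> W' i" by metis
    define f where "f = (\<lambda>v. h (a (\<kappa> v)) v)"
    have fW: "f v \<in> W' (a (\<kappa> v))" "f v div n = a (\<kappa> v)" "\<kappa> v < k" "a (\<kappa> v) < r" "f v < r * n"
      if "v \<in> verts G" for v
    proof -
      show 1: "f v \<in> W' (a (\<kappa> v))" using h(2) that by (auto simp: f_def)
      then show 2: "f v div n = a (\<kappa> v)" by (rule divW)
      show 3: "\<kappa> v < k" using \<kappa> that by (auto simp: proper_coloring_def)
      then show "a (\<kappa> v) < r" using a(2) by auto
      then show "f v < r * n" using 2 n by (metis div_less_iff_less_mult)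
    qed
    have inj_f: "inj_on f (verts G)"
    proof (rule inj_onI)
      fix u v assume uv: "u \<in> verts G" "v \<in> verts G" "f u = f v"
      \<comment> \<open>The part containing \<open>f u\<close> tells which of the injections
        \<open>h i\<close> was applied.\<close>
      then have "a (\<kappa> u) = a (\<kappa> v)" using fW(2) by metis
      then show "u = v" using uv inj_on_eq_iff[OF h(1)] by (simp add: f_def)
    qed
    have ed: "f ` e \<in> edges (complete_multipartite r n) \<and> c (f ` e) = b" if "e \<in> edges G" for e
    proof -
      have "e \<in> [verts G]\<^bsup>2\<^esup>" using G that by (auto simp: fin_ugraph_def)
      then obtain u v where uv: "e = {u, v}" "u \<in> verts G" "v \<in> verts G"
        by (auto simp: nsets_def card_2_iff)
      then have neq: "\<kappa> u \<noteq> \<kappa> v" using \<kappa> that unfolding proper_coloring_def by blast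
      then have "a (\<kappa> u) \<noteq> a (\<kappa> v)" using inj_on_eq_iff[OF a(1)] fW(3) uv(2,3) by simp
      then have "f ` e \<in> edges (complete_multipartite r n)"
        using edges_complete_multipartite fW(2,5)[OF uv(2)] fW(2,5)[OF uv(3)] by (simp add: uv(1))
      moreover have "c {f u, f v} = b"
        by (rule mono[OF fW(3)[OF uv(2)] fW(3)[OF uv(3)] neq fW(1)[OF uv(2)] fW(1)[OF uv(3)]])
      ultimately show ?thesis using uv by simp
    qed
    have "f ` verts G \<subseteq> verts (complete_multipartite r n)"
      using fW(5) by (auto simp: complete_multipartite_def)
    then have "is_copy G (complete_multipartite r n) f"
      using inj_f ed by (simp add: is_copy_def)
    with ed show ?thesis by blast
  qed
  then show thesis using that[OF n] unfolding arrows_def by blast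
qed

theorem theorem1p3:
  fixes k g :: nat
  assumes "1 \<le> k" and "1 \<le> g"
  shows "\<exists>G :: nat ugraph. fin_ugraph G \<and> chromatic_number G = k \<and> enat g \<le> girth G \<and>
           chromatic_ramsey_number G = ramsey_number k"
proof -
  define r where "r = ramsey_number k"
  \<comment> \<open>A copy of the \<open>k\<close>-clique needs \<open>k\<close> distinct vertices.
    This gives \<open>r > 0\<close> and lets colorings with fewer than \<open>k\<close> colors count
    as \<open>r\<close>-colorings.\<close>
  have rk: "k \<le> r"
    using ramsey_number_arrows[of k] card_inj_on_le[of _ "{..<k}" "{..<r}"]
    unfolding arrows_complete_iff r_def by auto
  then have pos: "k > 0" "r > 0" using assms(1) by auto
  obtain G :: "nat ugraph" and \<kappa> where G: "fin_ugraph G" "proper_coloring G k \<kappa>" "enat g \<le> girth G"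
    "\<And>f. f \<in> verts G \<rightarrow> {..<r} \<Longrightarrow> \<exists>a. a ` {..<k} \<subseteq> f ` verts G \<and>
       (\<forall>i<k. \<forall>j<k. i \<noteq> j \<longrightarrow> (\<exists>u v. {u, v} \<in> edges G \<and> f u = a i \<and> f v = a j))"
    by (rule sparse_graph_exists[OF pos, where g = g]) (rule that; blast)
  have "chromatic_number G = k"
  proof (rule chromatic_number_eqI[OF G(2)], rule ccontr)
    fix m c assume c: "proper_coloring G m c" and "\<not> k \<le> m"
    then have "c \<in> verts G \<rightarrow> {..<r}" using rk by (force simp: proper_coloring_def)
    from G(4)[OF this] obtain a where a: "a ` {..<k} \<subseteq> c ` verts G"
      "\<forall>i<k. \<forall>j<k. i \<noteq> j \<longrightarrow> (\<exists>u v. {u, v} \<in> edges G \<and> c u = a i \<and> c v = a j)"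
      by (elim exE conjE)
    \<comment> \<open>For a proper coloring, joined classes have different colors, so
      \<open>k\<close> joined classes need \<open>k\<close> colors.\<close>
    have "a i \<noteq> a j" if "i < k" "j < k" "i \<noteq> j" for i j
      using a(2)[rule_format, OF that] c unfolding proper_coloring_def by metis
    then have "inj_on a {..<k}" by (meson inj_onI lessThan_iff)
    moreover have "c ` verts G \<subseteq> {..<m}" using c by (auto simp: proper_coloring_def)
    with a(1) have "a ` {..<k} \<subseteq> {..<m}" by (rule subset_trans)
    ultimately show False using card_inj_on_le[of a "{..<k}" "{..<m}"] \<open>\<not> k \<le> m\<close> by auto
  qed
  moreover have "chromatic_ramsey_number G = r"
    unfolding chromatic_ramsey_number_def
  proof (rule Least_equality)
    obtain n where "n > 0" "arrows (complete_multipartite r n) G"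
      using complete_multipartite_arrows[OF G(1,2) ramsey_number_arrows[of k, folded r_def]] .
    then show "\<exists>F :: nat ugraph. fin_ugraph F \<and> chromatic_number F = r \<and> arrows F G"
      using fin_complete_multipartite chromatic_number_complete_multipartite by blast
  next
    fix m assume "\<exists>F :: nat ugraph. fin_ugraph F \<and> chromatic_number F = m \<and> arrows F G"
    then obtain F :: "nat ugraph" where F: "fin_ugraph F" "chromatic_number F = m" "arrows F G"
      by blast
    from chromatic_number_ge_ramsey_number[OF F(1,3) G(4)[unfolded r_def]]
    show "r \<le> m" unfolding F(2) r_def .
  qed
  ultimately show ?thesis using G(1,3) unfolding r_def by blast
qed

end
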